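(* Let $X_1,X_2,Y_1,Y_2$ be non-negative random variables with distributions $F_1,F_2,G_1,G_2$ respectively, all from the class $\mathcal{D}\cap\mathcal{L}$. Assume that $X_1,X_2,Y_1,Y_2$ are generalized tail asymptotically independent (GTAI) and that $(X_k,Y_l)\in(\mathcal{D}\cap\mathcal{L})^{(2)}$ for all $k,l\in\{1,2\}$. Then $$\mathbf{P}[X_1+X_2>x,\ Y_1+Y_2>y]\sim\sum_{k=1}^2\sum_{l=1}^2\mathbf{P}[X_k>x,\ Y_l>y],\qquad x\wedge y\to\infty.$$ If, further, $X_1,X_2$ are tail asymptotically independent (TAI) and $Y_1,Y_2$ are TAI, then $(X_1+X_2,\,Y_1+Y_2)\in(\mathcal{D}\cap\mathcal{L})^{(2)}$.
   Context: Notation: $x\wedge y=\min\{x,y\}$; $f(x,y)\sim g(x,y)$ as $x\wedge y\to\infty$ means $\lim_{x\wedge y\to\infty} f(x,y)/g(x,y)=1$. For a distribution $F$, $\overline F=1-F$; all distributions satisfy $\overline F(x)>0$ for all $x\ge 0$. Joint tails appearing in denominators or as conditioning events are implicitly assumed positive. One-dimensional classes: $F\in\mathcal{L}$ (long-tailed) if $\lim_{x\to\infty}\overline F(x-a)/\overline F(x)=1$ for every $a>0$. $F\in\mathcal{D}$ (dominatedly varying) if $\limsup_{x\to\infty}\overline F(bx)/\overline F(x)<\infty$ for some (equivalently all) $b\in(0,1)$. Two-dimensional classes: let $(X,Y)$ have marginal distributions $F,G$. We write $(X,Y)\in\mathcal{L}^{(2)}$ if $F,G\in\mathcal{L}$ and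 $\lim_{x\wedge y\to\infty}\mathbf{P}[X>x-a_1,Y>y-a_2]/\mathbf{P}[X>x,Y>y]=1$ for every $(a_1,a_2)\in[0,\infty)^2\setminus\{(0,0)\}$. We write $(X,Y)\in\mathcal{D}^{(2)}$ if $F,G\in\mathcal{D}$ and $\limsup_{x\wedge y\to\infty}\mathbf{P}[X>b_1x,Y>b_2y]/\mathbf{P}[X>x,Y>y]<\infty$ for some (equivalently all) $(b_1,b_2)\in(0,1)^2$. Finally $(\mathcal{D}\cap\mathcal{L})^{(2)}=\mathcal{D}^{(2)}\cap\mathcal{L}^{(2)}$. GTAI: $X_1,\ldots,X_n,Y_1,\ldots,Y_m$ are GTAI if (1) $\lim_{\min\{x_i,x_k,y_j\}\to\infty}\mathbf{P}[|X_i|>x_i\mid X_k>x_k,Y_j>y_j]=0$ for all $1\le i\ne k\le n$, $1\le j\le m$; and (2) $\lim_{\min\{x_i,y_k,y_j\}\to\infty}\mathbf{P}[|Y_j|>y_j\mid X_i>x_i,Y_k>y_k]=0$ for all $1\le j\ne k\le m$, $1\le i\le n$. Here $n=m=2$. TAI: $X_1,\ldots,X_n$ are TAI if $\lim_{x_i\wedge x_j\to\infty}\mathbf{P}[|X_i|>x_i\mid X_j>x_j]=0$ for all $i\ne j$ in $\{1,\ldots,n\}$. *)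

theory Defs
  imports "HOL-Probability.Probability"
begin

text \<open>
  Limits as \<open>x \<and> y \<rightarrow> \<infinity>\<close> (the minimum tends to infinity) are limits along the
  product filter \<open>at_top \<times>\<^sub>F at_top\<close>. Tail probabilities that occur as a denominator
  or as the probability of a conditioning event are required to be positive in each
  definition, since division by zero would otherwise make some conditions vacuous. The scaling factors
  in the dominated variation classes are existential; by monotonicity of the tails
  this is equivalent to quantifying over all of them.
\<close>

definition tail :: "real measure \<Rightarrow> real \<Rightarrow> real" where
  "tail \<mu> x = 1 - cdf \<mu> x"

definition joint_tail :: "'a measure \<Rightarrow> ('a \<Rightarrow> real) \<Rightarrow> ('a \<Rightarrow> real) \<Rightarrow> real \<Rightarrow> real \<Rightarrow> real" where
  "joint_tail M X Y x y = \<P>(\<omega> in M. X \<omega> > x \<and> Y \<omega> > y)"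

definition long_tailed :: "real measure \<Rightarrow> bool" where
  "long_tailed \<mu> \<longleftrightarrow>
     (\<forall>x\<ge>0. tail \<mu> x > 0) \<and>
     (\<forall>a>0. ((\<lambda>x. tail \<mu> (x - a) / tail \<mu> x) \<longlongrightarrow> 1) at_top)"

definition dominatedly_varying :: "real measure \<Rightarrow> bool" where
  "dominatedly_varying \<mu> \<longleftrightarrow>
     (\<forall>x\<ge>0. tail \<mu> x > 0) \<and>
     (\<exists>b\<in>{0<..<1}. Limsup at_top (\<lambda>x. ereal (tail \<mu> (b * x) / tail \<mu> x)) < \<infinity>)"

definition long_tailed2 :: "'a measure \<Rightarrow> ('a \<Rightarrow> real) \<Rightarrow> ('a \<Rightarrow> real) \<Rightarrow> bool" where
  "long_tailed2 M X Y \<longleftrightarrow>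
     long_tailed (distr M borel X) \<and> long_tailed (distr M borel Y) \<and>
     (\<forall>x\<ge>0. \<forall>y\<ge>0. joint_tail M X Y x y > 0) \<and>
     (\<forall>a1\<ge>0. \<forall>a2\<ge>0. (a1, a2) \<noteq> (0, 0) \<longrightarrow>
        ((\<lambda>(x, y). joint_tail M X Y (x - a1) (y - a2) / joint_tail M X Y x y) \<longlongrightarrow> 1)
          (at_top \<times>\<^sub>F at_top))"

definition dominatedly_varying2 :: "'a measure \<Rightarrow> ('a \<Rightarrow> real) \<Rightarrow> ('a \<Rightarrow> real) \<Rightarrow> bool" where
  "dominatedly_varying2 M X Y \<longleftrightarrow>
     dominatedly_varying (distr M borel X) \<and> dominatedly_varying (distr M borel Y) \<and>
     (\<forall>x\<ge>0. \<forall>y\<ge>0. joint_tail M X Y x y > 0) \<and>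
     (\<exists>b1\<in>{0<..<1}. \<exists>b2\<in>{0<..<1}.
        Limsup (at_top \<times>\<^sub>F at_top)
          (\<lambda>(x, y). ereal (joint_tail M X Y (b1 * x) (b2 * y) / joint_tail M X Y x y)) < \<infinity>)"

definition DL :: "real measure \<Rightarrow> bool" where
  "DL \<mu> \<longleftrightarrow> dominatedly_varying \<mu> \<and> long_tailed \<mu>"

definition DL2 :: "'a measure \<Rightarrow> ('a \<Rightarrow> real) \<Rightarrow> ('a \<Rightarrow> real) \<Rightarrow> bool" where
  "DL2 M X Y \<longleftrightarrow> dominatedly_varying2 M X Y \<and> long_tailed2 M X Y"

text \<open>
  (Generalized) tail asymptotic independence. Sequences are indexed from 1, so only
  \<open>X 1, \<dots>, X n\<close> and \<open>Y 1, \<dots>, Y m\<close> are relevant.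
\<close>

definition GTAI :: "'a measure \<Rightarrow> nat \<Rightarrow> nat \<Rightarrow> (nat \<Rightarrow> 'a \<Rightarrow> real) \<Rightarrow> (nat \<Rightarrow> 'a \<Rightarrow> real) \<Rightarrow> bool" where
  "GTAI M n m X Y \<longleftrightarrow>
     (\<forall>i\<in>{1..n}. \<forall>k\<in>{1..n}. \<forall>j\<in>{1..m}. i \<noteq> k \<longrightarrow>
        (\<forall>x\<ge>0. \<forall>y\<ge>0. joint_tail M (X k) (Y j) x y > 0) \<and>
        ((\<lambda>(xi, xk, yj). \<P>(\<omega> in M. \<bar>X i \<omega>\<bar> > xi \<bar> X k \<omega> > xk \<and> Y j \<omega> > yj)) \<longlongrightarrow> 0)
          (at_top \<times>\<^sub>F at_top \<times>\<^sub>F at_top)) \<and>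
     (\<forall>j\<in>{1..m}. \<forall>k\<in>{1..m}. \<forall>i\<in>{1..n}. j \<noteq> k \<longrightarrow>
        (\<forall>x\<ge>0. \<forall>y\<ge>0. joint_tail M (X i) (Y k) x y > 0) \<and>
        ((\<lambda>(xi, yk, yj). \<P>(\<omega> in M. \<bar>Y j \<omega>\<bar> > yj \<bar> X i \<omega> > xi \<and> Y k \<omega> > yk)) \<longlongrightarrow> 0)
          (at_top \<times>\<^sub>F at_top \<times>\<^sub>F at_top))"

definition TAI :: "'a measure \<Rightarrow> nat \<Rightarrow> (nat \<Rightarrow> 'a \<Rightarrow> real) \<Rightarrow> bool" where
  "TAI M n X \<longleftrightarrow>
     (\<forall>i\<in>{1..n}. \<forall>j\<in>{1..n}. i \<noteq> j \<longrightarrow>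
        (\<forall>x\<ge>0. \<P>(\<omega> in M. X j \<omega> > x) > 0) \<and>
        ((\<lambda>(xi, xj). \<P>(\<omega> in M. \<bar>X i \<omega>\<bar> > xi \<bar> X j \<omega> > xj)) \<longlongrightarrow> 0)
          (at_top \<times>\<^sub>F at_top))"

end

theory Submission
  imports Defs
begin

text \<open>
  The theorem is an instance of the principle of a single big jump, in each coordinate separately.
  Whenever \<open>X\<^sub>1 + X\<^sub>2 > x\<close>, some summand \<open>X\<^sub>k\<close> exceeds \<open>x / 2\<close>, and for any constant
  \<open>a > 0\<close> either this summand already exceeds \<open>x - a\<close>, or the other one exceeds \<open>a\<close>
  (lemma \<open>exceedance_of_sum\<close>); likewise for \<open>Y\<^sub>1 + Y\<^sub>2 > y\<close> with some index \<open>l\<close>. Hence the event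
  \<open>{X\<^sub>1 + X\<^sub>2 > x, Y\<^sub>1 + Y\<^sub>2 > y}\<close> is covered by the four main events
  \<open>{X\<^sub>k > x - a, Y\<^sub>l > y - a}\<close> and by error events in which \<open>X\<^sub>k > x / 2\<close> and \<open>Y\<^sub>l > y / 2\<close>
  are accompanied by a third variable that exceeds \<open>a\<close>.

  Long-tailedness says that the main events have asymptotically the probabilities
  \<open>P[X\<^sub>k > x, Y\<^sub>l > y]\<close>. For an error event, GTAI bounds the probability by a multiple of
  \<open>P[X\<^sub>k > x / 2, Y\<^sub>l > y / 2]\<close> with a factor that is arbitrarily small once \<open>a\<close> is large,
  and dominated variation replaces \<open>x / 2, y / 2\<close> by \<open>x, y\<close> at the cost of a
  constant (lemma \<open>eventually_joint_exceed_le\<close>). The order of the choices matters: first the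
  accuracy, then \<open>a\<close>, then \<open>x\<close> and \<open>y\<close>.

  For the lower bound, non-negativity makes a single exceedance \<open>X\<^sub>k > x, Y\<^sub>l > y\<close>
  sufficient. The four such events become disjoint when the parts on which the other \<open>X\<close> or
  the other \<open>Y\<close> is large as well are removed, and these parts are negligible by GTAI again.

  The passage from the two set inclusions to the asymptotic equivalence uses only an
  arbitrary filter (lemma \<open>sandwich_asymp_equiv_sum\<close>), so the same argument yields
  \<open>P[X\<^sub>1 + X\<^sub>2 > x] \<sim> P[X\<^sub>1 > x] + P[X\<^sub>2 > x]\<close> from TAI, and with it the closure of the
  class \<open>D \<inter> L\<close> for the marginals (lemma \<open>DL_sum_of_TAI\<close>). The second claim then follows because
  both long-tailedness and dominated variation are statements about the behaviour of a function under
  a substitution that is compatible with the filter. They pass to finite sums of non-negative functions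
  and from a function to any asymptotically equivalent one.
\<close>

section \<open>Asymptotics of finite sums along a filter\<close>

lemma summand_bigo_sum_nonneg:
  fixes g :: "'i \<Rightarrow> 'p \<Rightarrow> real"
  assumes "finite I" "i \<in> I" and nonneg: "\<And>i p. i \<in> I \<Longrightarrow> 0 \<le> g i p"
  shows "g i \<in> O[F](\<lambda>p. \<Sum>i\<in>I. g i p)"
proof (intro landau_o.big_mono always_eventually allI)
  fix p
  show "norm (g i p) \<le> norm (\<Sum>i\<in>I. g i p)"
    using member_le_sum[of i I "\<lambda>i. g i p"] assms by (simp add: sum_nonneg)
qed

lemma asymp_equiv_sum_nonneg:
  fixes f g :: "'i \<Rightarrow> 'p \<Rightarrow> real"
  assumes "finite I"
    and equiv: "\<And>i. i \<in> I \<Longrightarrow> f i \<sim>[F] g i"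
    and nonneg: "\<And>i p. i \<in> I \<Longrightarrow> 0 \<le> g i p"
  shows "(\<lambda>p. \<Sum>i\<in>I. f i p) \<sim>[F] (\<lambda>p. \<Sum>i\<in>I. g i p)"
proof -
  have "(\<lambda>p. f i p - g i p) \<in> o[F](\<lambda>p. \<Sum>i\<in>I. g i p)" if i: "i \<in> I" for i
  proof -
    have "(\<lambda>p. f i p - g i p) \<in> o[F](g i)"
      using equiv[OF i] by (simp add: asymp_equiv_altdef)
    moreover have "g i \<in> O[F](\<lambda>p. \<Sum>i\<in>I. g i p)"
      using \<open>finite I\<close> i nonneg by (rule summand_bigo_sum_nonneg)
    ultimately show ?thesis
      by (rule landau_o.small_big_trans)
  qed
  then have "(\<lambda>p. \<Sum>i\<in>I. f i p - g i p) \<in> o[F](\<lambda>p. \<Sum>i\<in>I. g i p)"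
    by (intro big_sum_in_smallo)
  then show ?thesis
    by (simp add: asymp_equiv_altdef sum_subtractf)
qed

lemma sum_bigo_nonneg:
  fixes f g :: "'i \<Rightarrow> 'p \<Rightarrow> real"
  assumes "finite I"
    and bigo: "\<And>i. i \<in> I \<Longrightarrow> f i \<in> O[F](g i)"
    and nonneg: "\<And>i p. i \<in> I \<Longrightarrow> 0 \<le> g i p"
  shows "(\<lambda>p. \<Sum>i\<in>I. f i p) \<in> O[F](\<lambda>p. \<Sum>i\<in>I. g i p)"
proof (rule big_sum_in_bigo)
  fix i assume i: "i \<in> I"
  have "g i \<in> O[F](\<lambda>p. \<Sum>i\<in>I. g i p)"
    using \<open>finite I\<close> i nonneg by (rule summand_bigo_sum_nonneg)
  then show "f i \<in> O[F](\<lambda>p. \<Sum>i\<in>I. g i p)"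
    using bigo[OF i] landau_o.big_trans by blast
qed

text \<open>
  The analytic core of the single big jump argument. Here \<open>s\<close> is the tail of the sum, the \<open>h i\<close>
  are the tails of the summands, \<open>\<phi> a\<close> shifts the arguments by \<open>a\<close>, and \<open>r\<close>, \<open>q\<close> are
  the errors of the upper and the lower bound. Since \<open>s\<close> does not depend on \<open>a\<close>, the
  error \<open>r\<close> may be small relative to \<open>h\<close> only in the iterated sense: for each
  accuracy there is a suitable fixed \<open>a\<close>.
\<close>

lemma sandwich_asymp_equiv_sum:
  fixes s :: "'p \<Rightarrow> real" and h :: "'i \<Rightarrow> 'p \<Rightarrow> real" and \<phi> :: "real \<Rightarrow> 'p \<Rightarrow> 'p"
  assumes "finite I"
    and nonneg: "\<And>i p. i \<in> I \<Longrightarrow> 0 \<le> h i p"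
    and upper: "\<And>a p. 0 < a \<Longrightarrow> s p \<le> (\<Sum>i\<in>I. h i (\<phi> a p)) + (\<Sum>i\<in>I. r i a p)"
    and lower: "\<And>p. (\<Sum>i\<in>I. h i p) \<le> s p + (\<Sum>i\<in>I. q i p)"
    and shift: "\<And>i a. i \<in> I \<Longrightarrow> 0 < a \<Longrightarrow> (\<lambda>p. h i (\<phi> a p)) \<sim>[F] h i"
    and r: "\<And>i e. i \<in> I \<Longrightarrow> 0 < e \<Longrightarrow> \<forall>\<^sub>F a in at_top. \<forall>\<^sub>F p in F. r i a p \<le> e * h i p"
    and q: "\<And>i e. i \<in> I \<Longrightarrow> 0 < e \<Longrightarrow> \<forall>\<^sub>F p in F. q i p \<le> e * h i p"
  shows "s \<sim>[F] (\<lambda>p. \<Sum>i\<in>I. h i p)"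
  unfolding asymp_equiv_altdef
proof (rule landau_o.smallI)
  fix c :: real assume "0 < c"
  define H where "H p = (\<Sum>i\<in>I. h i p)" for p
  have H_nonneg: "0 \<le> H p" for p
    using nonneg by (simp add: H_def sum_nonneg)
  have "\<forall>\<^sub>F a in at_top. \<forall>i\<in>I. \<forall>\<^sub>F p in F. r i a p \<le> c / 2 * h i p"
    using \<open>finite I\<close> r[where e = "c / 2"] \<open>0 < c\<close> by (intro eventually_ball_finite ballI) simp_all
  then have "\<forall>\<^sub>F a in at_top. 0 < a \<and> (\<forall>i\<in>I. \<forall>\<^sub>F p in F. r i a p \<le> c / 2 * h i p)"
    using eventually_gt_at_top by (rule eventually_conj[rotated])
  then obtain a where "0 < a" and ra: "\<And>i. i \<in> I \<Longrightarrow> \<forall>\<^sub>F p in F. r i a p \<le> c / 2 * h i p"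
    by (auto dest!: eventually_happens)
  have "(\<lambda>p. \<Sum>i\<in>I. h i (\<phi> a p)) \<sim>[F] H"
    unfolding H_def using \<open>finite I\<close> shift \<open>0 < a\<close> nonneg
    by (intro asymp_equiv_sum_nonneg) auto
  then have "\<forall>\<^sub>F p in F. norm ((\<Sum>i\<in>I. h i (\<phi> a p)) - H p) \<le> c / 2 * norm (H p)"
    using \<open>0 < c\<close> unfolding asymp_equiv_altdef by (intro landau_o.smallD) auto
  moreover have "\<forall>\<^sub>F p in F. \<forall>i\<in>I. r i a p \<le> c / 2 * h i p"
    using \<open>finite I\<close> ra by (intro eventually_ball_finite) auto
  moreover have "\<forall>\<^sub>F p in F. \<forall>i\<in>I. q i p \<le> c * h i p"
    using \<open>finite I\<close> q \<open>0 < c\<close> by (intro eventually_ball_finite) auto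
  ultimately have "\<forall>\<^sub>F p in F. norm (s p - H p) \<le> c * norm (H p)"
  proof eventually_elim
    case (elim p)
    have "(\<Sum>i\<in>I. r i a p) \<le> c / 2 * H p"
      unfolding H_def sum_distrib_left using elim by (intro sum_mono) auto
    moreover have "(\<Sum>i\<in>I. q i p) \<le> c * H p"
      unfolding H_def sum_distrib_left using elim by (intro sum_mono) auto
    moreover have "(\<Sum>i\<in>I. h i (\<phi> a p)) - H p \<le> c / 2 * H p"
      using elim(1) H_nonneg[of p] abs_ge_self[of "(\<Sum>i\<in>I. h i (\<phi> a p)) - H p"] by simp
    ultimately have "s p - H p \<le> c * H p" "H p - s p \<le> c * H p"
      using upper[OF \<open>0 < a\<close>, of p] lower[of p, folded H_def] by linarith+
    then show ?case
      using H_nonneg[of p] by (simp add: abs_le_iff)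
  qed
  then show "\<forall>\<^sub>F p in F. norm (s p - (\<Sum>i\<in>I. h i p)) \<le> c * norm (\<Sum>i\<in>I. h i p)"
    by (simp add: H_def)
qed

lemma asymp_equiv_transfer_shift:
  fixes s h :: "'p \<Rightarrow> real"
  assumes "s \<sim>[F] h" "(\<lambda>p. h (\<phi> p)) \<sim>[F] h" "filterlim \<phi> F F"
  shows "(\<lambda>p. s (\<phi> p)) \<sim>[F] s"
  using asymp_equiv_compose'[OF assms(1,3)] assms(1,2)
  by (meson asymp_equiv_symI asymp_equiv_trans)

lemma bigo_transfer_scaling:
  fixes s h :: "'p \<Rightarrow> real"
  assumes "s \<sim>[F] h" "(\<lambda>p. h (\<psi> p)) \<in> O[F](h)" "filterlim \<psi> F F"
  shows "(\<lambda>p. s (\<psi> p)) \<in> O[F](s)"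
  using asymp_equiv_imp_bigo[OF asymp_equiv_compose'[OF assms(1,3)]] assms(1,2)
  by (meson asymp_equiv_imp_bigo asymp_equiv_symI landau_o.big_trans)

text \<open>
  Dominated variation is given for some scaling factors only. Iterating the scaling makes the
  factors as small as desired, in particular at most \<open>1 / 2\<close>.
\<close>

lemma bigo_funpow:
  fixes h :: "'p \<Rightarrow> real"
  assumes "(\<lambda>p. h (\<psi> p)) \<in> O[F](h)" and lim: "filterlim \<psi> F F"
  shows "(\<lambda>p. h ((\<psi> ^^ n) p)) \<in> O[F](h)"
proof (induction n)
  case (Suc n)
  have "(\<lambda>p. h ((\<psi> ^^ n) (\<psi> p))) \<in> O[F](\<lambda>p. h (\<psi> p))"
    using landau_o.big.compose[OF Suc lim] .
  then have "(\<lambda>p. h ((\<psi> ^^ n) (\<psi> p))) \<in> O[F](h)"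
    using assms(1) landau_o.big_trans by blast
  then show ?case
    by (simp add: funpow_swap1)
qed simp

lemma Limsup_ratio_finite_iff_bigo:
  fixes f g :: "'p \<Rightarrow> real"
  assumes "\<forall>\<^sub>F p in F. 0 < g p" and "\<forall>\<^sub>F p in F. 0 \<le> f p"
  shows "Limsup F (\<lambda>p. ereal (f p / g p)) < \<infinity> \<longleftrightarrow> f \<in> O[F](g)"
proof
  assume "Limsup F (\<lambda>p. ereal (f p / g p)) < \<infinity>"
  then obtain n :: nat where "Limsup F (\<lambda>p. ereal (f p / g p)) < ereal (real n)"
    using less_PInf_Ex_of_nat by auto
  then have "\<forall>\<^sub>F p in F. ereal (f p / g p) < ereal (real n)"
    by (rule Limsup_lessD)
  with assms have "\<forall>\<^sub>F p in F. norm (f p) \<le> real n * norm (g p)"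
    by eventually_elim (auto simp: field_simps)
  then show "f \<in> O[F](g)"
    by (rule bigoI)
next
  assume "f \<in> O[F](g)"
  then obtain c where "\<forall>\<^sub>F p in F. norm (f p) \<le> c * norm (g p)"
    by (auto elim: landau_o.bigE)
  with assms have "\<forall>\<^sub>F p in F. ereal (f p / g p) \<le> ereal c"
    by eventually_elim (auto simp: field_simps)
  then have "Limsup F (\<lambda>p. ereal (f p / g p)) \<le> ereal c"
    by (rule Limsup_bounded)
  then show "Limsup F (\<lambda>p. ereal (f p / g p)) < \<infinity>"
    by (auto simp: le_less_trans)
qed

section \<open>Shifts and scalings of the quadrant\<close>

lemma eventually_at_top_prod_iff:
  "(\<forall>\<^sub>F p in at_top \<times>\<^sub>F at_top. P p) \<longleftrightarrow> (\<exists>N::real. \<forall>x\<ge>N. \<forall>y\<ge>N. P (x, y))"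
proof
  assume "\<forall>\<^sub>F p in at_top \<times>\<^sub>F at_top. P p"
  then obtain Q where "eventually Q at_top" and Q: "\<And>x y. Q x \<Longrightarrow> Q y \<Longrightarrow> P (x, y)"
    unfolding eventually_prod_same by blast
  then show "\<exists>N::real. \<forall>x\<ge>N. \<forall>y\<ge>N. P (x, y)"
    unfolding eventually_at_top_linorder by blast
next
  assume "\<exists>N::real. \<forall>x\<ge>N. \<forall>y\<ge>N. P (x, y)"
  then obtain N :: real where "\<forall>x\<ge>N. \<forall>y\<ge>N. P (x, y)" ..
  then show "\<forall>\<^sub>F p in at_top \<times>\<^sub>F at_top. P p"
    unfolding eventually_prod_same
    by (intro exI[of _ "\<lambda>x. N \<le> x"]) (auto simp: eventually_ge_at_top)
qed

lemma eventually_at_top_prod3_iff: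
  "(\<forall>\<^sub>F p in at_top \<times>\<^sub>F at_top \<times>\<^sub>F at_top. P p) \<longleftrightarrow>
   (\<exists>N::real. \<forall>x\<ge>N. \<forall>y\<ge>N. \<forall>z\<ge>N. P (x, y, z))"
proof
  assume "\<forall>\<^sub>F p in at_top \<times>\<^sub>F at_top \<times>\<^sub>F at_top. P p"
  then obtain Q R where "eventually Q at_top" "eventually R (at_top \<times>\<^sub>F at_top)"
    and P: "\<And>x p. Q x \<Longrightarrow> R p \<Longrightarrow> P (x, p)"
    unfolding eventually_prod_filter by blast
  then obtain K L where "\<forall>x\<ge>K. Q x" "\<forall>y\<ge>L. \<forall>z\<ge>L. R (y, z)"
    unfolding eventually_at_top_prod_iff eventually_at_top_linorder by blast
  with P show "\<exists>N::real. \<forall>x\<ge>N. \<forall>y\<ge>N. \<forall>z\<ge>N. P (x, y, z)"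
    by (intro exI[of _ "max K L"]) auto
next
  assume "\<exists>N::real. \<forall>x\<ge>N. \<forall>y\<ge>N. \<forall>z\<ge>N. P (x, y, z)"
  then obtain N :: real where "\<forall>x\<ge>N. \<forall>y\<ge>N. \<forall>z\<ge>N. P (x, y, z)" ..
  then show "\<forall>\<^sub>F p in at_top \<times>\<^sub>F at_top \<times>\<^sub>F at_top. P p"
    unfolding eventually_prod_filter[of P]
    by (intro exI[of _ "\<lambda>x. N \<le> x"] exI[of _ "\<lambda>(y, z). N \<le> y \<and> N \<le> z"])
       (auto simp: eventually_ge_at_top eventually_at_top_prod_iff)
qed

lemma filterlim_at_top_shift: "filterlim (\<lambda>x::real. x - a) at_top at_top"
  by real_asymp

lemma filterlim_at_top_scale: "0 < c \<Longrightarrow> filterlim (\<lambda>x::real. c * x) at_top at_top"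
  by real_asymp

lemma filterlim_at_top_prod_map:
  assumes "filterlim f at_top at_top" "filterlim g at_top at_top"
  shows "filterlim (\<lambda>p. (f (fst p), g (snd p))) (at_top \<times>\<^sub>F at_top) (at_top \<times>\<^sub>F at_top)"
  by (intro filterlim_Pair filterlim_compose[OF assms(1) filterlim_fst]
        filterlim_compose[OF assms(2) filterlim_snd])

lemma exists_power_le_half:
  fixes b :: real assumes "0 < b" "b < 1" shows "\<exists>n. \<forall>m\<ge>n. b ^ m \<le> 1 / 2"
proof -
  have "(\<lambda>n. b ^ n) \<longlonglongrightarrow> 0"
    using assms by (intro LIMSEQ_realpow_zero) auto
  then have "\<forall>\<^sub>F n in sequentially. b ^ n < 1 / 2"
    by (rule order_tendstoD) simp
  then show ?thesis
    unfolding eventually_sequentially by (meson less_imp_le)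
qed

section \<open>Tails of random variables\<close>

lemma asymp_equiv_shift_of_long_tailed:
  assumes "long_tailed \<mu>" "0 < a"
  shows "(\<lambda>x. tail \<mu> (x - a)) \<sim>[at_top] tail \<mu>"
  using assms by (auto simp: long_tailed_def intro!: asymp_equivI')

lemma asymp_equiv_shift_of_long_tailed2:
  assumes "long_tailed2 M V W" "0 \<le> a" "0 \<le> b" "(a, b) \<noteq> (0, 0)"
  shows "(\<lambda>p. joint_tail M V W (fst p - a) (snd p - b))
    \<sim>[at_top \<times>\<^sub>F at_top] (\<lambda>p. joint_tail M V W (fst p) (snd p))"
  using assms by (auto simp: long_tailed2_def case_prod_unfold intro!: asymp_equivI')

lemma DL_I:
  assumes pos: "\<And>x. 0 \<le> x \<Longrightarrow> 0 < tail \<mu> x"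
    and shift: "\<And>a. 0 < a \<Longrightarrow> (\<lambda>x. tail \<mu> (x - a)) \<sim>[at_top] tail \<mu>"
    and half: "(\<lambda>x. tail \<mu> (x / 2)) \<in> O[at_top](tail \<mu>)"
  shows "DL \<mu>"
proof -
  have ev: "\<forall>\<^sub>F x in at_top. 0 < tail \<mu> x"
    using eventually_ge_at_top[of 0] by eventually_elim (rule pos)
  have ev2: "\<forall>\<^sub>F x in at_top. 0 \<le> tail \<mu> (1 / 2 * x)"
    using eventually_ge_at_top[of 0] by eventually_elim (simp add: pos less_imp_le)
  have "((\<lambda>x. tail \<mu> (x - a) / tail \<mu> x) \<longlongrightarrow> 1) at_top" if "0 < a" for a
    using shift[OF that] by (rule asymp_equivD_strong) (use ev in eventually_elim, auto)
  moreover have "Limsup at_top (\<lambda>x. ereal (tail \<mu> (1 / 2 * x) / tail \<mu> x)) < \<infinity>"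
    using half Limsup_ratio_finite_iff_bigo[OF ev ev2] by simp
  moreover have "1 / 2 \<in> {0<..<1::real}"
    by simp
  ultimately show ?thesis
    unfolding DL_def long_tailed_def dominatedly_varying_def using pos by blast
qed

lemma DL2_I:
  assumes DL: "DL (distr M borel V)" "DL (distr M borel W)"
    and pos: "\<And>x y. 0 \<le> x \<Longrightarrow> 0 \<le> y \<Longrightarrow> 0 < joint_tail M V W x y"
    and shift: "\<And>a b. 0 \<le> a \<Longrightarrow> 0 \<le> b \<Longrightarrow> (a, b) \<noteq> (0, 0) \<Longrightarrow>
      (\<lambda>p. joint_tail M V W (fst p - a) (snd p - b))
        \<sim>[at_top \<times>\<^sub>F at_top] (\<lambda>p. joint_tail M V W (fst p) (snd p))"
    and half: "(\<lambda>p. joint_tail M V W (fst p / 2) (snd p / 2))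
        \<in> O[at_top \<times>\<^sub>F at_top](\<lambda>p. joint_tail M V W (fst p) (snd p))"
  shows "DL2 M V W"
proof -
  let ?F = "at_top \<times>\<^sub>F at_top :: (real \<times> real) filter"
  have ev: "\<forall>\<^sub>F p in ?F. 0 < joint_tail M V W (fst p) (snd p)"
    unfolding eventually_at_top_prod_iff by (auto intro: pos)
  have ev2: "\<forall>\<^sub>F p in ?F. 0 \<le> joint_tail M V W (1 / 2 * fst p) (1 / 2 * snd p)"
    by (simp add: joint_tail_def)
  have "((\<lambda>(x, y). joint_tail M V W (x - a) (y - b) / joint_tail M V W x y) \<longlongrightarrow> 1) ?F"
    if "0 \<le> a" "0 \<le> b" "(a, b) \<noteq> (0, 0)" for a b
    unfolding case_prod_unfold using shift[OF that]
    by (rule asymp_equivD_strong) (use ev in eventually_elim, auto)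
  moreover have "Limsup ?F (\<lambda>(x, y).
      ereal (joint_tail M V W (1 / 2 * x) (1 / 2 * y) / joint_tail M V W x y)) < \<infinity>"
    using half Limsup_ratio_finite_iff_bigo[OF ev ev2] by (simp add: case_prod_unfold)
  moreover have "1 / 2 \<in> {0<..<1::real}"
    by simp
  ultimately show ?thesis
    using DL pos unfolding DL2_def DL_def long_tailed2_def dominatedly_varying2_def by blast
qed

context prob_space
begin

lemma tail_distr:
  assumes [measurable]: "V \<in> borel_measurable M"
  shows "tail (distr M borel V) x = \<P>(\<omega> in M. x < V \<omega>)"
proof -
  have "cdf (distr M borel V) x = \<P>(\<omega> in M. \<not> x < V \<omega>)"
    unfolding cdf_def by (subst measure_distr) (auto intro!: arg_cong[where f = prob])
  also have "\<dots> = 1 - \<P>(\<omega> in M. x < V \<omega>)"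
    by (intro prob_neg) simp
  finally show ?thesis
    by (simp add: tail_def)
qed

lemma joint_tail_antimono:
  assumes [measurable]: "V \<in> borel_measurable M" "W \<in> borel_measurable M"
    and "x' \<le> x" "y' \<le> y"
  shows "joint_tail M V W x y \<le> joint_tail M V W x' y'"
  unfolding joint_tail_def using assms(3,4) by (intro finite_measure_mono) auto

text \<open>
  The factor \<open>b\<close> from the definition of dominated variation may be larger than \<open>1 / 2\<close>; monotonicity
  of the tail gives the claim as soon as \<open>b ^ n \<le> 1 / 2\<close>.
\<close>

lemma tail_half_bigo:
  assumes [measurable]: "V \<in> borel_measurable M"
    and dom: "dominatedly_varying (distr M borel V)"
  shows "(\<lambda>x. tail (distr M borel V) (x / 2)) \<in> O[at_top](tail (distr M borel V))"
proof -
  let ?h = "tail (distr M borel V)"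
  obtain b where b: "0 < b" "b < 1" and "Limsup at_top (\<lambda>x. ereal (?h (b * x) / ?h x)) < \<infinity>"
    using dom by (auto simp: dominatedly_varying_def)
  moreover have "\<forall>\<^sub>F x in at_top. 0 < ?h x"
    using eventually_ge_at_top[of 0]
    by eventually_elim (use dom in \<open>simp add: dominatedly_varying_def\<close>)
  ultimately have "(\<lambda>x. ?h (b * x)) \<in> O[at_top](?h)"
    by (subst (asm) Limsup_ratio_finite_iff_bigo) (auto simp: tail_distr)
  then have step: "(\<lambda>x. ?h (((*) b ^^ n) x)) \<in> O[at_top](?h)" for n
    using filterlim_at_top_scale[OF b(1)] by (rule bigo_funpow)
  have pow: "((*) b ^^ n) x = b ^ n * x" for n x
    by (induction n) auto
  obtain n where n: "b ^ n \<le> 1 / 2"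
    using exists_power_le_half[OF b] by auto
  have "(\<lambda>x. ?h (x / 2)) \<in> O[at_top](\<lambda>x. ?h (((*) b ^^ n) x))"
  proof (rule landau_o.big_mono)
    show "\<forall>\<^sub>F x in at_top. norm (?h (x / 2)) \<le> norm (?h (((*) b ^^ n) x))"
      using eventually_ge_at_top[of 0]
    proof eventually_elim
      case (elim x)
      have "b ^ n * x \<le> x / 2"
        using mult_right_mono[OF n elim] by simp
      then show ?case
        by (auto simp: tail_distr pow intro!: finite_measure_mono)
    qed
  qed
  with step show ?thesis
    by (rule landau_o.big_trans[rotated])
qed

lemma joint_tail_half_bigo:
  assumes [measurable]: "V \<in> borel_measurable M" "W \<in> borel_measurable M"
    and dom: "dominatedly_varying2 M V W"
  shows "(\<lambda>p. joint_tail M V W (fst p / 2) (snd p / 2))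
    \<in> O[at_top \<times>\<^sub>F at_top](\<lambda>p. joint_tail M V W (fst p) (snd p))"
proof -
  let ?F = "at_top \<times>\<^sub>F at_top :: (real \<times> real) filter"
  define h where "h p = joint_tail M V W (fst p) (snd p)" for p
  obtain b c where b: "0 < b" "b < 1" and c: "0 < c" "c < 1"
    and "Limsup ?F (\<lambda>p. ereal (h (b * fst p, c * snd p) / h p)) < \<infinity>"
    using dom by (auto simp: dominatedly_varying2_def case_prod_unfold h_def)
  moreover have "\<forall>\<^sub>F p in ?F. 0 < h p"
    using dom unfolding eventually_at_top_prod_iff dominatedly_varying2_def h_def by auto
  moreover define \<psi> where "\<psi> p = (b * fst p, c * snd p)" for p
  ultimately have "(\<lambda>p. h (\<psi> p)) \<in> O[?F](h)"
    by (subst (asm) Limsup_ratio_finite_iff_bigo) (auto simp: h_def joint_tail_def)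
  moreover have "filterlim \<psi> ?F ?F"
    unfolding \<psi>_def by (intro filterlim_at_top_prod_map filterlim_at_top_scale b c)
  ultimately have step: "(\<lambda>p. h ((\<psi> ^^ n) p)) \<in> O[?F](h)" for n
    by (rule bigo_funpow)
  have pow: "(\<psi> ^^ n) p = (b ^ n * fst p, c ^ n * snd p)" for n p
    by (induction n) (auto simp: \<psi>_def)
  obtain k l where kl: "\<forall>m\<ge>k. b ^ m \<le> 1 / 2" "\<forall>m\<ge>l. c ^ m \<le> 1 / 2"
    using exists_power_le_half[OF b] exists_power_le_half[OF c] by blast
  define n where "n = max k l"
  have n: "b ^ n \<le> 1 / 2" "c ^ n \<le> 1 / 2"
    using kl by (auto simp: n_def)
  have "(\<lambda>p. h (fst p / 2, snd p / 2)) \<in> O[?F](\<lambda>p. h ((\<psi> ^^ n) p))"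
  proof (rule landau_o.big_mono)
    show "\<forall>\<^sub>F p in ?F. norm (h (fst p / 2, snd p / 2)) \<le> norm (h ((\<psi> ^^ n) p))"
      unfolding eventually_at_top_prod_iff
    proof (intro exI[of _ 0] allI impI)
      fix x y :: real assume xy: "0 \<le> x" "0 \<le> y"
      have "h (x / 2, y / 2) \<le> h (b ^ n * x, c ^ n * y)"
        unfolding h_def using mult_right_mono[OF n(1) xy(1)] mult_right_mono[OF n(2) xy(2)]
        by (intro joint_tail_antimono) auto
      then show "norm (h (fst (x, y) / 2, snd (x, y) / 2)) \<le> norm (h ((\<psi> ^^ n) (x, y)))"
        by (simp add: pow) (simp add: h_def joint_tail_def)
    qed
  qed
  with step have "(\<lambda>p. h (fst p / 2, snd p / 2)) \<in> O[?F](h)"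
    by (rule landau_o.big_trans[rotated])
  then show ?thesis
    by (simp add: h_def[abs_def])
qed

section \<open>Joint exceedances\<close>

lemma exceed_both_le_of_cond_prob:
  fixes U :: "'a \<Rightarrow> real"
  assumes [measurable]: "U \<in> borel_measurable M" "Measurable.pred M Q"
    and "\<P>(\<omega> in M. u < \<bar>U \<omega>\<bar> \<bar> Q \<omega>) < e" "0 < \<P>(\<omega> in M. Q \<omega>)"
  shows "\<P>(\<omega> in M. u < U \<omega> \<and> Q \<omega>) \<le> e * \<P>(\<omega> in M. Q \<omega>)"
proof -
  have "\<P>(\<omega> in M. u < U \<omega> \<and> Q \<omega>) \<le> \<P>(\<omega> in M. u < \<bar>U \<omega>\<bar> \<and> Q \<omega>)"
    by (intro finite_measure_mono) auto
  also have "\<dots> \<le> e * \<P>(\<omega> in M. Q \<omega>)"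
    using assms(3,4) by (simp add: cond_prob_def field_simps)
  finally show ?thesis .
qed

text \<open>
  Both conditions of GTAI have this shape, with \<open>U\<close> being the other \<open>X\<close> or the other \<open>Y\<close>. Written
  as an inequality for the joint probability, it is free of conditioning and of absolute values.
\<close>

definition negligible_given ::
    "('a \<Rightarrow> real) \<Rightarrow> ('a \<Rightarrow> real) \<Rightarrow> ('a \<Rightarrow> real) \<Rightarrow> bool" where
  "negligible_given U V W \<longleftrightarrow>
     (\<forall>e>0. \<exists>N. \<forall>u\<ge>N. \<forall>v\<ge>N. \<forall>w\<ge>N.
        \<P>(\<omega> in M. u < U \<omega> \<and> v < V \<omega> \<and> w < W \<omega>) \<le> e * joint_tail M V W v w)"

lemma GTAI_negligible_given:
  assumes gtai: "GTAI M n m X Y"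
    and X: "\<And>k. k \<in> {1..n} \<Longrightarrow> X k \<in> borel_measurable M"
    and Y: "\<And>l. l \<in> {1..m} \<Longrightarrow> Y l \<in> borel_measurable M"
  shows "\<lbrakk>i \<in> {1..n}; k \<in> {1..n}; l \<in> {1..m}; i \<noteq> k\<rbrakk> \<Longrightarrow> negligible_given (X i) (X k) (Y l)"
    and "\<lbrakk>j \<in> {1..m}; l \<in> {1..m}; k \<in> {1..n}; j \<noteq> l\<rbrakk> \<Longrightarrow> negligible_given (Y j) (X k) (Y l)"
proof -
  assume ik: "i \<in> {1..n}" "k \<in> {1..n}" "l \<in> {1..m}" "i \<noteq> k"
  have [measurable]: "X i \<in> borel_measurable M" "X k \<in> borel_measurable M" "Y l \<in> borel_measurable M"
    using X Y ik by auto
  show "negligible_given (X i) (X k) (Y l)"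
    unfolding negligible_given_def
  proof (intro allI impI)
    fix e :: real assume "0 < e"
    have pos: "0 < joint_tail M (X k) (Y l) v w" if "0 \<le> v" "0 \<le> w" for v w
      using gtai ik that unfolding GTAI_def by blast
    have "((\<lambda>(u, v, w). \<P>(\<omega> in M. \<bar>X i \<omega>\<bar> > u \<bar> X k \<omega> > v \<and> Y l \<omega> > w)) \<longlongrightarrow> 0)
        (at_top \<times>\<^sub>F at_top \<times>\<^sub>F at_top)"
      using gtai ik unfolding GTAI_def by blast
    from order_tendstoD(2)[OF this \<open>0 < e\<close>] obtain N where
      "\<forall>u\<ge>N. \<forall>v\<ge>N. \<forall>w\<ge>N. \<P>(\<omega> in M. \<bar>X i \<omega>\<bar> > u \<bar> X k \<omega> > v \<and> Y l \<omega> > w) < e"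
      unfolding eventually_at_top_prod3_iff by auto
    then show "\<exists>N. \<forall>u\<ge>N. \<forall>v\<ge>N. \<forall>w\<ge>N.
        \<P>(\<omega> in M. u < X i \<omega> \<and> v < X k \<omega> \<and> w < Y l \<omega>) \<le> e * joint_tail M (X k) (Y l) v w"
      using pos unfolding joint_tail_def
      by (intro exI[of _ "max N 0"] allI impI exceed_both_le_of_cond_prob) auto
  qed
next
  assume jl: "j \<in> {1..m}" "l \<in> {1..m}" "k \<in> {1..n}" "j \<noteq> l"
  have [measurable]: "Y j \<in> borel_measurable M" "X k \<in> borel_measurable M" "Y l \<in> borel_measurable M"
    using X Y jl by auto
  show "negligible_given (Y j) (X k) (Y l)"
    unfolding negligible_given_def
  proof (intro allI impI)
    fix e :: real assume "0 < e"
    have pos: "0 < joint_tail M (X k) (Y l) v w" if "0 \<le> v" "0 \<le> w" for v w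
      using gtai jl that unfolding GTAI_def by blast
    have "((\<lambda>(v, w, u). \<P>(\<omega> in M. \<bar>Y j \<omega>\<bar> > u \<bar> X k \<omega> > v \<and> Y l \<omega> > w)) \<longlongrightarrow> 0)
        (at_top \<times>\<^sub>F at_top \<times>\<^sub>F at_top)"
      using gtai jl unfolding GTAI_def by blast
    from order_tendstoD(2)[OF this \<open>0 < e\<close>] obtain N where
      "\<forall>v\<ge>N. \<forall>w\<ge>N. \<forall>u\<ge>N. \<P>(\<omega> in M. \<bar>Y j \<omega>\<bar> > u \<bar> X k \<omega> > v \<and> Y l \<omega> > w) < e"
      unfolding eventually_at_top_prod3_iff by auto
    then show "\<exists>N. \<forall>u\<ge>N. \<forall>v\<ge>N. \<forall>w\<ge>N.
        \<P>(\<omega> in M. u < Y j \<omega> \<and> v < X k \<omega> \<and> w < Y l \<omega>) \<le> e * joint_tail M (X k) (Y l) v w"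
      using pos unfolding joint_tail_def
      by (intro exI[of _ "max N 0"] allI impI exceed_both_le_of_cond_prob) auto
  qed
qed

text \<open>
  The error terms of the upper bound. The threshold for \<open>U\<close> is a constant, since asymptotic
  independence holds uniformly once all three thresholds exceed the same \<open>N\<close>. It is applied with
  accuracy \<open>e / C\<close>, where \<open>C\<close> bounds the growth of the joint tail when both arguments are halved.
\<close>

lemma eventually_joint_exceed_le:
  assumes [measurable]: "V \<in> borel_measurable M" "W \<in> borel_measurable M"
    and dom: "dominatedly_varying2 M V W" and neg: "negligible_given U V W" and "0 < e"
  shows "\<forall>\<^sub>F a in at_top. \<forall>\<^sub>F p in at_top \<times>\<^sub>F at_top.
    \<P>(\<omega> in M. a < U \<omega> \<and> fst p / 2 < V \<omega> \<and> snd p / 2 < W \<omega>)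
      \<le> e * joint_tail M V W (fst p) (snd p)"
proof -
  let ?F = "at_top \<times>\<^sub>F at_top :: (real \<times> real) filter"
  obtain C where "0 < C" and "\<forall>\<^sub>F p in ?F. norm (joint_tail M V W (fst p / 2) (snd p / 2))
      \<le> C * norm (joint_tail M V W (fst p) (snd p))"
    by (rule landau_o.bigE[OF joint_tail_half_bigo[OF assms(1,2) dom]])
  then have C: "\<forall>\<^sub>F p in ?F. joint_tail M V W (fst p / 2) (snd p / 2)
      \<le> C * joint_tail M V W (fst p) (snd p)"
    by (simp add: joint_tail_def)
  obtain N where N: "\<And>u v w. N \<le> u \<Longrightarrow> N \<le> v \<Longrightarrow> N \<le> w \<Longrightarrow>
      \<P>(\<omega> in M. u < U \<omega> \<and> v < V \<omega> \<and> w < W \<omega>) \<le> e / C * joint_tail M V W v w"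
    using neg[unfolded negligible_given_def, rule_format, of "e / C"] \<open>0 < e\<close> \<open>0 < C\<close> by auto
  have large: "\<forall>\<^sub>F p in ?F. N \<le> fst p / 2 \<and> N \<le> snd p / 2"
    unfolding eventually_at_top_prod_iff by (auto intro!: exI[of _ "2 * N"])
  show ?thesis
    using eventually_ge_at_top[of N]
  proof eventually_elim
    case (elim a)
    from C large show ?case
    proof eventually_elim
      case p: (elim p)
      have "\<P>(\<omega> in M. a < U \<omega> \<and> fst p / 2 < V \<omega> \<and> snd p / 2 < W \<omega>)
          \<le> e / C * joint_tail M V W (fst p / 2) (snd p / 2)"
        using elim p by (intro N) auto
      also have "\<dots> \<le> e / C * (C * joint_tail M V W (fst p) (snd p))"
        using p \<open>0 < e\<close> \<open>0 < C\<close> by (intro mult_left_mono) auto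
      finally show ?case
        using \<open>0 < C\<close> by simp
    qed
  qed
qed

lemma eventually_exceed_le:
  assumes [measurable]: "V \<in> borel_measurable M"
    and dom: "dominatedly_varying (distr M borel V)"
    and neg: "\<And>e. 0 < e \<Longrightarrow> \<exists>N. \<forall>u\<ge>N. \<forall>v\<ge>N.
      \<P>(\<omega> in M. u < U \<omega> \<and> v < V \<omega>) \<le> e * tail (distr M borel V) v"
    and "0 < e"
  shows "\<forall>\<^sub>F a in at_top. \<forall>\<^sub>F x in at_top.
    \<P>(\<omega> in M. a < U \<omega> \<and> x / 2 < V \<omega>) \<le> e * tail (distr M borel V) x"
proof -
  obtain C where "0 < C" and "\<forall>\<^sub>F x in at_top. norm (tail (distr M borel V) (x / 2))
      \<le> C * norm (tail (distr M borel V) x)"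
    by (rule landau_o.bigE[OF tail_half_bigo[OF assms(1) dom]])
  then have C: "\<forall>\<^sub>F x in at_top. tail (distr M borel V) (x / 2)
      \<le> C * tail (distr M borel V) x"
    by (simp add: tail_distr)
  obtain N where N: "\<And>u v. N \<le> u \<Longrightarrow> N \<le> v \<Longrightarrow>
      \<P>(\<omega> in M. u < U \<omega> \<and> v < V \<omega>) \<le> e / C * tail (distr M borel V) v"
    using neg[of "e / C"] \<open>0 < e\<close> \<open>0 < C\<close> by auto
  show ?thesis
    using eventually_ge_at_top[of N]
  proof eventually_elim
    case (elim a)
    from C eventually_ge_at_top[of "2 * N"] show ?case
    proof eventually_elim
      case x: (elim x)
      have "\<P>(\<omega> in M. a < U \<omega> \<and> x / 2 < V \<omega>) \<le> e / C * tail (distr M borel V) (x / 2)"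
        using elim x by (intro N) auto
      also have "\<dots> \<le> e / C * (C * tail (distr M borel V) x)"
        using x \<open>0 < e\<close> \<open>0 < C\<close> by (intro mult_left_mono) auto
      finally show ?case
        using \<open>0 < C\<close> by simp
    qed
  qed
qed

lemma TAI_exceed_le:
  assumes tai: "TAI M n X" and X: "\<And>k. k \<in> {1..n} \<Longrightarrow> X k \<in> borel_measurable M"
    and ik: "i \<in> {1..n}" "k \<in> {1..n}" "i \<noteq> k" and "0 < e"
  shows "\<exists>N. \<forall>u\<ge>N. \<forall>v\<ge>N.
    \<P>(\<omega> in M. u < X i \<omega> \<and> v < X k \<omega>) \<le> e * tail (distr M borel (X k)) v"
proof -
  have [measurable]: "X i \<in> borel_measurable M" "X k \<in> borel_measurable M"
    using X ik by auto
  have pos: "0 < \<P>(\<omega> in M. v < X k \<omega>)" if "0 \<le> v" for v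
    using tai ik that unfolding TAI_def by blast
  have "((\<lambda>(u, v). \<P>(\<omega> in M. \<bar>X i \<omega>\<bar> > u \<bar> X k \<omega> > v)) \<longlongrightarrow> 0) (at_top \<times>\<^sub>F at_top)"
    using tai ik unfolding TAI_def by blast
  from order_tendstoD(2)[OF this \<open>0 < e\<close>] obtain N where
    "\<forall>u\<ge>N. \<forall>v\<ge>N. \<P>(\<omega> in M. \<bar>X i \<omega>\<bar> > u \<bar> X k \<omega> > v) < e"
    unfolding eventually_at_top_prod_iff by auto
  then show ?thesis
    using pos
    by (intro exI[of _ "max N 0"] allI impI)
       (simp add: tail_distr, intro exceed_both_le_of_cond_prob, auto)
qed

end

section \<open>Sums of two random variables\<close>

text \<open>
  One of the two terms exceeds \<open>x / 2\<close>; let \<open>k\<close> be its index. If \<open>z k \<le> x - a\<close>, the other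
  term must make up for more than \<open>a\<close>. The index of the other term is \<open>3 - k\<close>.
\<close>

lemma exceedance_of_sum:
  fixes z :: "nat \<Rightarrow> real"
  assumes "x < z 1 + z 2"
  obtains k where "k \<in> {1..2}" "x / 2 < z k" "x - a < z k \<or> a < z (3 - k)"
proof (cases "x / 2 < z 1")
  case True
  then show ?thesis
    using that[of 1] assms by (cases "x - a < z 1") auto
next
  case False
  then show ?thesis
    using that[of 2] assms by (cases "x - a < z 2") auto
qed

context prob_space
begin

text \<open>
  The single big jump in one dimension: the tail of the sum is equivalent to
  \<open>P[X\<^sub>1 > x] + P[X\<^sub>2 > x]\<close>, and the defining properties of the class are carried over from there.
\<close>

lemma DL_sum_of_TAI:
  fixes X :: "nat \<Rightarrow> 'a \<Rightarrow> real"
  assumes X: "\<And>k. k \<in> {1..2} \<Longrightarrow> X k \<in> borel_measurable M"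
    and nonneg: "\<And>k. k \<in> {1..2} \<Longrightarrow> AE \<omega> in M. 0 \<le> X k \<omega>"
    and DL: "\<And>k. k \<in> {1..2} \<Longrightarrow> DL (distr M borel (X k))"
    and tai: "TAI M 2 X"
  shows "DL (distr M borel (\<lambda>\<omega>. X 1 \<omega> + X 2 \<omega>))"
proof -
  note One_nat_def [simp del]
  define I :: "nat set" where "I = {1..2}"
  have I: "I = {1, 2}" "finite I"
    by (auto simp: I_def)
  have [measurable]: "X 1 \<in> borel_measurable M" "X 2 \<in> borel_measurable M"
    using X by auto
  have Xm: "X k \<in> borel_measurable M" if "k \<in> I" for k
    using X that by (simp add: I_def)
  define h where "h k = tail (distr M borel (X k))" for k
  define s where "s = tail (distr M borel (\<lambda>\<omega>. X 1 \<omega> + X 2 \<omega>))"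
  have h_eq: "h k x = \<P>(\<omega> in M. x < X k \<omega>)" if "k \<in> I" for k x
    using tail_distr[OF Xm[OF that]] by (simp add: h_def)
  have s_eq: "s x = \<P>(\<omega> in M. x < X 1 \<omega> + X 2 \<omega>)" for x
    by (simp add: s_def tail_distr)
  have h_nonneg: "0 \<le> h k x" if "k \<in> I" for k x
    by (simp add: h_eq that)
  have other: "3 - k \<in> I" "3 - k \<noteq> k" if "k \<in> I" for k
    using that by (auto simp: I)
  have shift: "(\<lambda>x. h k (x - a)) \<sim>[at_top] h k" if "k \<in> I" "0 < a" for k a
    unfolding h_def using DL that by (intro asymp_equiv_shift_of_long_tailed) (auto simp: DL_def I_def)
  have half: "(\<lambda>x. h k (x / 2)) \<in> O[at_top](h k)" if "k \<in> I" for k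
    unfolding h_def using DL that Xm by (intro tail_half_bigo) (auto simp: DL_def I_def)
  have neg: "\<exists>N. \<forall>u\<ge>N. \<forall>v\<ge>N. \<P>(\<omega> in M. u < X (3 - k) \<omega> \<and> v < X k \<omega>) \<le> e * h k v"
    if "k \<in> I" "0 < e" for k e
    unfolding h_def using X that other[OF that(1)]
    by (intro TAI_exceed_le[OF tai]) (auto simp: I_def)
  have equiv: "s \<sim>[at_top] (\<lambda>x. \<Sum>k\<in>I. h k x)"
  proof (rule sandwich_asymp_equiv_sum[where \<phi> = "\<lambda>a x. x - a"
      and r = "\<lambda>k a x. \<P>(\<omega> in M. a < X (3 - k) \<omega> \<and> x / 2 < X k \<omega>)"
      and q = "\<lambda>k x. \<P>(\<omega> in M. x < X (3 - k) \<omega> \<and> x < X k \<omega>)"])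
    fix a x :: real
    define A where "A k = {\<omega> \<in> space M. x - a < X k \<omega>}" for k
    define B where "B k = {\<omega> \<in> space M. a < X (3 - k) \<omega> \<and> x / 2 < X k \<omega>}" for k
    have "A k \<in> events" "B k \<in> events" if "k \<in> I" for k
    proof -
      note [measurable] = Xm[OF that] Xm[OF other(1)[OF that]]
      show "A k \<in> events" "B k \<in> events"
        unfolding A_def B_def by measurable
    qed
    then have AB: "A ` I \<subseteq> events" "B ` I \<subseteq> events"
      by auto
    have "s x \<le> prob ((\<Union>k\<in>I. A k) \<union> (\<Union>k\<in>I. B k))"
      unfolding s_eq
    proof (rule finite_measure_mono)
      show "{\<omega> \<in> space M. x < X 1 \<omega> + X 2 \<omega>} \<subseteq> (\<Union>k\<in>I. A k) \<union> (\<Union>k\<in>I. B k)"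
      proof
        fix \<omega> assume "\<omega> \<in> {\<omega> \<in> space M. x < X 1 \<omega> + X 2 \<omega>}"
        then have \<omega>: "\<omega> \<in> space M" "x < X 1 \<omega> + X 2 \<omega>"
          by auto
        then obtain k where "k \<in> {1..2}" "x / 2 < X k \<omega>" "x - a < X k \<omega> \<or> a < X (3 - k) \<omega>"
          using exceedance_of_sum[of x "\<lambda>k. X k \<omega>" a] by blast
        with \<omega> show "\<omega> \<in> (\<Union>k\<in>I. A k) \<union> (\<Union>k\<in>I. B k)"
          by (auto simp: A_def B_def I_def)
      qed
    qed (use AB I in auto)
    also have "\<dots> \<le> prob (\<Union>k\<in>I. A k) + prob (\<Union>k\<in>I. B k)"
      using AB I by (intro measure_Un_le) auto
    also have "\<dots> \<le> (\<Sum>k\<in>I. prob (A k)) + (\<Sum>k\<in>I. prob (B k))"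
      using AB I by (intro add_mono finite_measure_subadditive_finite) auto
    finally show "s x \<le> (\<Sum>k\<in>I. h k (x - a))
        + (\<Sum>k\<in>I. \<P>(\<omega> in M. a < X (3 - k) \<omega> \<and> x / 2 < X k \<omega>))"
      by (simp add: h_eq A_def B_def)
  next
    fix x :: real
    \<comment> \<open>Exactly one summand exceeds the level, which makes these events disjoint.\<close>
    define D where "D k = {\<omega> \<in> space M. x < X k \<omega> \<and> \<not> x < X (3 - k) \<omega>}" for k
    define E where "E k = {\<omega> \<in> space M. x < X (3 - k) \<omega> \<and> x < X k \<omega>}" for k
    have "D k \<in> events" "E k \<in> events" if "k \<in> I" for k
    proof -
      note [measurable] = Xm[OF that] Xm[OF other(1)[OF that]]
      show "D k \<in> events" "E k \<in> events"
        unfolding D_def E_def by measurable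
    qed
    then have DE: "D ` I \<subseteq> events" "E ` I \<subseteq> events"
      by auto
    have disj: "disjoint_family_on D I"
      by (auto simp: disjoint_family_on_def I D_def)
    have "h k x \<le> prob (D k) + prob (E k)" if k: "k \<in> I" for k
    proof -
      have "h k x = prob (D k \<union> E k)"
        unfolding h_eq[OF k] by (rule arg_cong[where f = prob]) (auto simp: D_def E_def)
      also have "\<dots> \<le> prob (D k) + prob (E k)"
        using DE k by (intro measure_Un_le) auto
      finally show ?thesis .
    qed
    then have "(\<Sum>k\<in>I. h k x) \<le> (\<Sum>k\<in>I. prob (D k)) + (\<Sum>k\<in>I. prob (E k))"
      by (simp add: sum_mono flip: sum.distrib)
    also have "(\<Sum>k\<in>I. prob (D k)) = prob (\<Union>k\<in>I. D k)"
      using DE disj I by (intro finite_measure_finite_Union[symmetric]) auto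
    also have "prob (\<Union>k\<in>I. D k) \<le> s x"
      unfolding s_eq
    proof (rule finite_measure_mono_AE)
      show "AE \<omega> in M. \<omega> \<in> (\<Union>k\<in>I. D k) \<longrightarrow> \<omega> \<in> {\<omega> \<in> space M. x < X 1 \<omega> + X 2 \<omega>}"
        using nonneg[of 1, simplified] nonneg[of 2, simplified]
        by eventually_elim (auto simp: I D_def)
    qed simp
    finally show "(\<Sum>k\<in>I. h k x) \<le> s x
        + (\<Sum>k\<in>I. \<P>(\<omega> in M. x < X (3 - k) \<omega> \<and> x < X k \<omega>))"
      by (simp add: E_def)
  next
    fix k and e :: real assume k: "k \<in> I" and "0 < e"
    show "\<forall>\<^sub>F a in at_top. \<forall>\<^sub>F x in at_top.
        \<P>(\<omega> in M. a < X (3 - k) \<omega> \<and> x / 2 < X k \<omega>) \<le> e * h k x"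
      unfolding h_def using Xm[OF k] neg[OF k] DL[of k] k \<open>0 < e\<close>
      by (intro eventually_exceed_le) (auto simp: DL_def h_def I_def)
    obtain N where "\<forall>u\<ge>N. \<forall>v\<ge>N. \<P>(\<omega> in M. u < X (3 - k) \<omega> \<and> v < X k \<omega>) \<le> e * h k v"
      using neg[OF k \<open>0 < e\<close>] by blast
    then show "\<forall>\<^sub>F x in at_top. \<P>(\<omega> in M. x < X (3 - k) \<omega> \<and> x < X k \<omega>) \<le> e * h k x"
      unfolding eventually_at_top_linorder by blast
  qed (use I h_nonneg shift in auto)
  show ?thesis
  proof (rule DL_I; fold s_def)
    fix x :: real assume "0 \<le> x"
    then have "0 < h 1 x"
      using DL[of 1] by (simp add: h_def DL_def long_tailed_def)
    also have "h 1 x \<le> s x"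
      unfolding h_eq[of 1, unfolded I, simplified] s_eq
    proof (rule finite_measure_mono_AE)
      show "AE \<omega> in M. \<omega> \<in> {\<omega> \<in> space M. x < X 1 \<omega>}
          \<longrightarrow> \<omega> \<in> {\<omega> \<in> space M. x < X 1 \<omega> + X 2 \<omega>}"
        using nonneg[of 2, simplified] by eventually_elim auto
    qed simp
    finally show "0 < s x" .
  next
    fix a :: real assume "0 < a"
    then show "(\<lambda>x. s (x - a)) \<sim>[at_top] s"
      using I shift h_nonneg
      by (intro asymp_equiv_transfer_shift[OF equiv] asymp_equiv_sum_nonneg
            filterlim_at_top_shift) auto
  next
    have "filterlim (\<lambda>x::real. x / 2) at_top at_top"
      by real_asymp
    then show "(\<lambda>x. s (x / 2)) \<in> O[at_top](s)"
      using I half h_nonneg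
      by (intro bigo_transfer_scaling[OF equiv] sum_bigo_nonneg) auto
  qed
qed

text \<open>
  The index set consists of the pairs \<open>(k, l)\<close> that tell which \<open>X\<close> and which \<open>Y\<close> make the big jump.
\<close>

lemma joint_tail_sum_asymp_equiv:
  fixes X Y :: "nat \<Rightarrow> 'a \<Rightarrow> real"
  assumes X: "\<And>k. k \<in> {1..2} \<Longrightarrow> X k \<in> borel_measurable M"
    and Y: "\<And>l. l \<in> {1..2} \<Longrightarrow> Y l \<in> borel_measurable M"
    and X_nonneg: "\<And>k. k \<in> {1..2} \<Longrightarrow> AE \<omega> in M. 0 \<le> X k \<omega>"
    and Y_nonneg: "\<And>l. l \<in> {1..2} \<Longrightarrow> AE \<omega> in M. 0 \<le> Y l \<omega>"
    and gtai: "GTAI M 2 2 X Y"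
    and DL2: "\<And>k l. k \<in> {1..2} \<Longrightarrow> l \<in> {1..2} \<Longrightarrow> DL2 M (X k) (Y l)"
  shows "(\<lambda>p. joint_tail M (\<lambda>\<omega>. X 1 \<omega> + X 2 \<omega>) (\<lambda>\<omega>. Y 1 \<omega> + Y 2 \<omega>) (fst p) (snd p))
    \<sim>[at_top \<times>\<^sub>F at_top] (\<lambda>p. \<Sum>(k, l)\<in>{1..2} \<times> {1..2}. joint_tail M (X k) (Y l) (fst p) (snd p))"
proof -
  let ?F = "at_top \<times>\<^sub>F at_top :: (real \<times> real) filter"
  note One_nat_def [simp del]
  define I :: "(nat \<times> nat) set" where "I = {1..2} \<times> {1..2}"
  have "{1..2::nat} = {1, 2}"
    by auto
  then have I: "I = {(1, 1), (1, 2), (2, 1), (2, 2)}" "finite I"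
    by (auto simp: I_def)
  have [measurable]: "X 1 \<in> borel_measurable M" "X 2 \<in> borel_measurable M"
      "Y 1 \<in> borel_measurable M" "Y 2 \<in> borel_measurable M"
    using X Y by auto
  have I_D: "fst i \<in> {1..2}" "snd i \<in> {1..2}" "3 - fst i \<in> {1..2}" "3 - snd i \<in> {1..2}"
      "3 - fst i \<noteq> fst i" "3 - snd i \<noteq> snd i" if "i \<in> I" for i
    using that by (auto simp: I)
  define h where "h i p = joint_tail M (X (fst i)) (Y (snd i)) (fst p) (snd p)" for i p
  define s where "s p = joint_tail M (\<lambda>\<omega>. X 1 \<omega> + X 2 \<omega>) (\<lambda>\<omega>. Y 1 \<omega> + Y 2 \<omega>) (fst p) (snd p)"
    for p
  \<comment> \<open>The error events: besides the pair \<open>(k, l) = i\<close>, the other \<open>X\<close> or the other \<open>Y\<close> is large.\<close>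
  define BX where "BX i a x y =
      {\<omega> \<in> space M. a < X (3 - fst i) \<omega> \<and> x < X (fst i) \<omega> \<and> y < Y (snd i) \<omega>}"
    for i a x y
  define BY where "BY i b x y =
      {\<omega> \<in> space M. b < Y (3 - snd i) \<omega> \<and> x < X (fst i) \<omega> \<and> y < Y (snd i) \<omega>}"
    for i b x y
  have B_events: "BX i a x y \<in> events" "BY i a x y \<in> events" if "i \<in> I" for i a x y
  proof -
    note [measurable] =
        X[OF I_D(1)[OF that]] X[OF I_D(3)[OF that]] Y[OF I_D(2)[OF that]] Y[OF I_D(4)[OF that]]
    show "BX i a x y \<in> events" "BY i a x y \<in> events"
      unfolding BX_def BY_def by measurable
  qed
  have neg: "negligible_given (X (3 - fst i)) (X (fst i)) (Y (snd i))"
      "negligible_given (Y (3 - snd i)) (X (fst i)) (Y (snd i))" if "i \<in> I" for i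
    using GTAI_negligible_given[OF gtai X Y] I_D[OF that] by blast+
  have "s \<sim>[?F] (\<lambda>p. \<Sum>i\<in>I. h i p)"
  proof (rule sandwich_asymp_equiv_sum[where \<phi> = "\<lambda>a p. (fst p - a, snd p - a)"
      and r = "\<lambda>i a p. prob (BX i a (fst p / 2) (snd p / 2)) + prob (BY i a (fst p / 2) (snd p / 2))"
      and q = "\<lambda>i p. prob (BX i (fst p) (fst p) (snd p)) + prob (BY i (snd p) (fst p) (snd p))"])
    fix a :: real and p :: "real \<times> real"
    obtain x y where p: "p = (x, y)" by fastforce
    define A where "A i = {\<omega> \<in> space M. x - a < X (fst i) \<omega> \<and> y - a < Y (snd i) \<omega>}" for i
    let ?BX = "\<lambda>i. BX i a (x / 2) (y / 2)" and ?BY = "\<lambda>i. BY i a (x / 2) (y / 2)"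
    have ev: "A ` I \<subseteq> events" "?BX ` I \<subseteq> events" "?BY ` I \<subseteq> events"
      using B_events by (auto simp: I A_def)
    then have ev': "(\<Union>i\<in>I. A i) \<in> events" "(\<Union>i\<in>I. ?BX i) \<in> events" "(\<Union>i\<in>I. ?BY i) \<in> events"
      using I(2) by auto
    have "s p \<le> prob ((\<Union>i\<in>I. A i) \<union> ((\<Union>i\<in>I. ?BX i) \<union> (\<Union>i\<in>I. ?BY i)))"
      unfolding s_def joint_tail_def p fst_conv snd_conv
    proof (rule finite_measure_mono)
      show "{\<omega> \<in> space M. x < X 1 \<omega> + X 2 \<omega> \<and> y < Y 1 \<omega> + Y 2 \<omega>}
          \<subseteq> (\<Union>i\<in>I. A i) \<union> ((\<Union>i\<in>I. ?BX i) \<union> (\<Union>i\<in>I. ?BY i))"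
      proof
        fix \<omega> assume "\<omega> \<in> {\<omega> \<in> space M. x < X 1 \<omega> + X 2 \<omega> \<and> y < Y 1 \<omega> + Y 2 \<omega>}"
        then have \<omega>: "\<omega> \<in> space M" and sx: "x < X 1 \<omega> + X 2 \<omega>" and sy: "y < Y 1 \<omega> + Y 2 \<omega>"
          by auto
        obtain k where k: "k \<in> {1..2}" "x / 2 < X k \<omega>" "x - a < X k \<omega> \<or> a < X (3 - k) \<omega>"
          using exceedance_of_sum[of x "\<lambda>k. X k \<omega>" a, OF sx] .
        obtain l where l: "l \<in> {1..2}" "y / 2 < Y l \<omega>" "y - a < Y l \<omega> \<or> a < Y (3 - l) \<omega>"
          using exceedance_of_sum[of y "\<lambda>k. Y k \<omega>" a, OF sy] .
        have "(k, l) \<in> I"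
          using k l by (simp add: I_def)
        moreover have "\<omega> \<in> A (k, l) \<or> \<omega> \<in> ?BX (k, l) \<or> \<omega> \<in> ?BY (k, l)"
          using k l \<omega> by (auto simp: A_def BX_def BY_def)
        ultimately show "\<omega> \<in> (\<Union>i\<in>I. A i) \<union> ((\<Union>i\<in>I. ?BX i) \<union> (\<Union>i\<in>I. ?BY i))"
          by blast
      qed
    qed (use ev' in auto)
    also have "\<dots> \<le> prob (\<Union>i\<in>I. A i) + (prob (\<Union>i\<in>I. ?BX i) + prob (\<Union>i\<in>I. ?BY i))"
      using ev' by (intro order_trans[OF measure_Un_le] add_left_mono
          measure_Un_le) auto
    also have "\<dots> \<le> (\<Sum>i\<in>I. prob (A i)) + ((\<Sum>i\<in>I. prob (?BX i)) + (\<Sum>i\<in>I. prob (?BY i)))"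
      using ev I(2) by (intro add_mono finite_measure_subadditive_finite) auto
    finally show "s p \<le> (\<Sum>i\<in>I. h i (fst p - a, snd p - a))
        + (\<Sum>i\<in>I. prob (BX i a (fst p / 2) (snd p / 2)) + prob (BY i a (fst p / 2) (snd p / 2)))"
      by (simp add: h_def joint_tail_def A_def p sum.distrib)
  next
    fix p :: "real \<times> real"
    obtain x y where p: "p = (x, y)" by fastforce
    \<comment> \<open>Exactly one \<open>X\<close> and exactly one \<open>Y\<close> exceed their levels.\<close>
    define D where "D i = {\<omega> \<in> space M. x < X (fst i) \<omega> \<and> \<not> x < X (3 - fst i) \<omega>
        \<and> y < Y (snd i) \<omega> \<and> \<not> y < Y (3 - snd i) \<omega>}" for i
    let ?E = "\<lambda>i. BX i x x y" and ?E' = "\<lambda>i. BY i y x y"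
    have "D i \<in> events" if "i \<in> I" for i
    proof -
      note [measurable] =
        X[OF I_D(1)[OF that]] X[OF I_D(3)[OF that]] Y[OF I_D(2)[OF that]] Y[OF I_D(4)[OF that]]
      show ?thesis
        unfolding D_def by measurable
    qed
    then have D: "D ` I \<subseteq> events"
      by auto
    have disj: "disjoint_family_on D I"
      unfolding disjoint_family_on_def
    proof (intro ballI impI)
      fix i j assume "i \<in> I" "j \<in> I" "i \<noteq> j"
      then have "fst j = 3 - fst i \<or> snd j = 3 - snd i"
        by (auto simp: I)
      then show "D i \<inter> D j = {}"
        by (auto simp: D_def)
    qed
    have "h i p \<le> prob (D i) + (prob (?E i) + prob (?E' i))" if i: "i \<in> I" for i
    proof -
      have "h i p = prob (D i \<union> (?E i \<union> ?E' i))"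
        unfolding h_def joint_tail_def p fst_conv snd_conv
        by (rule arg_cong[where f = prob]) (auto simp: D_def BX_def BY_def)
      also have "\<dots> \<le> prob (D i) + (prob (?E i) + prob (?E' i))"
        using D B_events i by (intro order_trans[OF measure_Un_le] add_left_mono
            measure_Un_le) auto
      finally show ?thesis .
    qed
    then have "(\<Sum>i\<in>I. h i p) \<le> (\<Sum>i\<in>I. prob (D i)) + (\<Sum>i\<in>I. prob (?E i) + prob (?E' i))"
      by (subst sum.distrib[symmetric]) (rule sum_mono)
    also have "(\<Sum>i\<in>I. prob (D i)) = prob (\<Union>i\<in>I. D i)"
      using D disj I by (intro finite_measure_finite_Union[symmetric]) auto
    also have "prob (\<Union>i\<in>I. D i) \<le> s p"
      unfolding s_def joint_tail_def p fst_conv snd_conv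
    proof (rule finite_measure_mono_AE)
      show "AE \<omega> in M. \<omega> \<in> (\<Union>i\<in>I. D i)
          \<longrightarrow> \<omega> \<in> {\<omega> \<in> space M. x < X 1 \<omega> + X 2 \<omega> \<and> y < Y 1 \<omega> + Y 2 \<omega>}"
        using X_nonneg[of 1, simplified] X_nonneg[of 2, simplified]
          Y_nonneg[of 1, simplified] Y_nonneg[of 2, simplified]
        by eventually_elim (auto simp: I D_def)
    qed simp
    finally show "(\<Sum>i\<in>I. h i p) \<le> s p
        + (\<Sum>i\<in>I. prob (BX i (fst p) (fst p) (snd p)) + prob (BY i (snd p) (fst p) (snd p)))"
      by (simp add: p)
  next
    fix i and e :: real assume i: "i \<in> I" and "0 < e"
    then have "0 < e / 2" by simp
    have meas: "X (fst i) \<in> borel_measurable M" "Y (snd i) \<in> borel_measurable M"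
      using X Y I_D[OF i] by auto
    have dom: "dominatedly_varying2 M (X (fst i)) (Y (snd i))"
      using DL2 I_D[OF i] by (auto simp: DL2_def)
    have "\<forall>\<^sub>F a in at_top. \<forall>\<^sub>F p in ?F. prob (BX i a (fst p / 2) (snd p / 2)) \<le> e / 2 * h i p"
      unfolding BX_def h_def by (intro eventually_joint_exceed_le meas dom neg i \<open>0 < e / 2\<close>)
    moreover have "\<forall>\<^sub>F a in at_top. \<forall>\<^sub>F p in ?F. prob (BY i a (fst p / 2) (snd p / 2)) \<le> e / 2 * h i p"
      unfolding BY_def h_def by (intro eventually_joint_exceed_le meas dom neg i \<open>0 < e / 2\<close>)
    ultimately show "\<forall>\<^sub>F a in at_top. \<forall>\<^sub>F p in ?F.
        prob (BX i a (fst p / 2) (snd p / 2)) + prob (BY i a (fst p / 2) (snd p / 2)) \<le> e * h i p"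
    proof eventually_elim
      case (elim a)
      then show ?case
        by eventually_elim (simp add: field_simps)
    qed
    obtain N where N: "\<forall>u\<ge>N. \<forall>v\<ge>N. \<forall>w\<ge>N. prob (BX i u v w) \<le> e / 2 * h i (v, w)"
      using neg(1)[OF i] \<open>0 < e / 2\<close> unfolding negligible_given_def BX_def h_def fst_conv snd_conv by blast
    obtain N' where N': "\<forall>u\<ge>N'. \<forall>v\<ge>N'. \<forall>w\<ge>N'. prob (BY i u v w) \<le> e / 2 * h i (v, w)"
      using neg(2)[OF i] \<open>0 < e / 2\<close> unfolding negligible_given_def BY_def h_def fst_conv snd_conv by blast
    show "\<forall>\<^sub>F p in ?F. prob (BX i (fst p) (fst p) (snd p)) + prob (BY i (snd p) (fst p) (snd p)) \<le> e * h i p"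
      unfolding eventually_at_top_prod_iff
    proof (intro exI[of _ "max N N'"] allI impI)
      fix x y assume "max N N' \<le> x" "max N N' \<le> y"
      then have "prob (BX i x x y) \<le> e / 2 * h i (x, y)" "prob (BY i y x y) \<le> e / 2 * h i (x, y)"
        using N N' by simp_all
      then show "prob (BX i (fst (x, y)) (fst (x, y)) (snd (x, y)))
          + prob (BY i (snd (x, y)) (fst (x, y)) (snd (x, y))) \<le> e * h i (x, y)"
        by (simp add: field_simps)
    qed
  next
    fix i and a :: real assume i: "i \<in> I" and "0 < a"
    then show "(\<lambda>p. h i (fst p - a, snd p - a)) \<sim>[?F] h i"
      unfolding h_def[abs_def] fst_conv snd_conv using DL2 I_D[OF i]
      by (intro asymp_equiv_shift_of_long_tailed2) (auto simp: DL2_def)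
  qed (use I in \<open>auto simp: h_def joint_tail_def\<close>)
  then show ?thesis
    by (simp add: s_def[abs_def] h_def I_def case_prod_unfold)
qed

end

theorem lemma4p4:
  fixes M :: "'a measure" and X Y :: "nat \<Rightarrow> 'a \<Rightarrow> real"
  assumes "prob_space M"
    and "\<And>k. k \<in> {1..2} \<Longrightarrow> X k \<in> borel_measurable M"
    and "\<And>l. l \<in> {1..2} \<Longrightarrow> Y l \<in> borel_measurable M"
    and "\<And>k. k \<in> {1..2} \<Longrightarrow> AE \<omega> in M. X k \<omega> \<ge> 0"
    and "\<And>l. l \<in> {1..2} \<Longrightarrow> AE \<omega> in M. Y l \<omega> \<ge> 0"
    and "\<And>k. k \<in> {1..2} \<Longrightarrow> DL (distr M borel (X k))"
    and "\<And>l. l \<in> {1..2} \<Longrightarrow> DL (distr M borel (Y l))"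
    and "GTAI M 2 2 X Y"
    and "\<And>k l. k \<in> {1..2} \<Longrightarrow> l \<in> {1..2} \<Longrightarrow> DL2 M (X k) (Y l)"
  shows "(\<lambda>(x, y). \<P>(\<omega> in M. X 1 \<omega> + X 2 \<omega> > x \<and> Y 1 \<omega> + Y 2 \<omega> > y))
           \<sim>[at_top \<times>\<^sub>F at_top]
         (\<lambda>(x, y). \<Sum>k=1..2. \<Sum>l=1..2. \<P>(\<omega> in M. X k \<omega> > x \<and> Y l \<omega> > y))
       \<and> (TAI M 2 X \<and> TAI M 2 Y \<longrightarrow>
            DL2 M (\<lambda>\<omega>. X 1 \<omega> + X 2 \<omega>) (\<lambda>\<omega>. Y 1 \<omega> + Y 2 \<omega>))"
proof -
  interpret prob_space M by fact
  note One_nat_def [simp del]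
  note X = assms(2) and Y = assms(3) and X_nonneg = assms(4) and Y_nonneg = assms(5)
    and gtai = assms(8) and DL2 = assms(9)
  have [measurable]: "X 1 \<in> borel_measurable M" "X 2 \<in> borel_measurable M"
      "Y 1 \<in> borel_measurable M" "Y 2 \<in> borel_measurable M"
    using X Y by auto
  let ?F = "at_top \<times>\<^sub>F at_top :: (real \<times> real) filter"
  define s where "s p = joint_tail M (\<lambda>\<omega>. X 1 \<omega> + X 2 \<omega>) (\<lambda>\<omega>. Y 1 \<omega> + Y 2 \<omega>) (fst p) (snd p)"
    for p
  define h where "h i p = joint_tail M (X (fst i)) (Y (snd i)) (fst p) (snd p)" for i p
  have h_nonneg: "0 \<le> h i p" for i p
    by (simp add: h_def joint_tail_def)
  have equiv: "s \<sim>[?F] (\<lambda>p. \<Sum>i\<in>{1..2} \<times> {1..2}. h i p)"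
    using joint_tail_sum_asymp_equiv[OF X Y X_nonneg Y_nonneg gtai DL2]
    by (simp add: s_def[abs_def] h_def case_prod_unfold)
  have "DL2 M (\<lambda>\<omega>. X 1 \<omega> + X 2 \<omega>) (\<lambda>\<omega>. Y 1 \<omega> + Y 2 \<omega>)" if "TAI M 2 X" "TAI M 2 Y"
  proof (rule DL2_I)
    show "DL (distr M borel (\<lambda>\<omega>. X 1 \<omega> + X 2 \<omega>))" "DL (distr M borel (\<lambda>\<omega>. Y 1 \<omega> + Y 2 \<omega>))"
      using assms that by (auto intro!: DL_sum_of_TAI)
  next
    fix x y :: real assume "0 \<le> x" "0 \<le> y"
    then have "0 < joint_tail M (X 1) (Y 1) x y"
      using DL2[of 1 1] by (simp add: DL2_def long_tailed2_def)
    also have "\<dots> \<le> joint_tail M (\<lambda>\<omega>. X 1 \<omega> + X 2 \<omega>) (\<lambda>\<omega>. Y 1 \<omega> + Y 2 \<omega>) x y"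
      unfolding joint_tail_def
    proof (rule finite_measure_mono_AE)
      show "AE \<omega> in M. \<omega> \<in> {\<omega> \<in> space M. x < X 1 \<omega> \<and> y < Y 1 \<omega>}
          \<longrightarrow> \<omega> \<in> {\<omega> \<in> space M. x < X 1 \<omega> + X 2 \<omega> \<and> y < Y 1 \<omega> + Y 2 \<omega>}"
        using X_nonneg[of 2, simplified] Y_nonneg[of 2, simplified] by eventually_elim auto
    qed simp
    finally show "0 < joint_tail M (\<lambda>\<omega>. X 1 \<omega> + X 2 \<omega>) (\<lambda>\<omega>. Y 1 \<omega> + Y 2 \<omega>) x y" .
  next
    fix a b :: real assume ab: "0 \<le> a" "0 \<le> b" "(a, b) \<noteq> (0, 0)"
    have "(\<lambda>p. h i (fst p - a, snd p - b)) \<sim>[?F] h i" if "i \<in> {1..2} \<times> {1..2}" for i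
    proof -
      have "long_tailed2 M (X (fst i)) (Y (snd i))"
        using DL2[of "fst i" "snd i"] that by (auto simp: DL2_def)
      from asymp_equiv_shift_of_long_tailed2[OF this ab] show ?thesis
        by (simp add: h_def[abs_def])
    qed
    then have "(\<lambda>p. s (fst p - a, snd p - b)) \<sim>[?F] s"
      using h_nonneg
      by (intro asymp_equiv_transfer_shift[OF equiv] asymp_equiv_sum_nonneg
            filterlim_at_top_prod_map filterlim_at_top_shift) auto
    then show "(\<lambda>p. joint_tail M (\<lambda>\<omega>. X 1 \<omega> + X 2 \<omega>) (\<lambda>\<omega>. Y 1 \<omega> + Y 2 \<omega>) (fst p - a) (snd p - b))
        \<sim>[?F] (\<lambda>p. joint_tail M (\<lambda>\<omega>. X 1 \<omega> + X 2 \<omega>) (\<lambda>\<omega>. Y 1 \<omega> + Y 2 \<omega>) (fst p) (snd p))"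
      by (simp add: s_def[abs_def])
  next
    have "(\<lambda>p. h i (1 / 2 * fst p, 1 / 2 * snd p)) \<in> O[?F](h i)" if "i \<in> {1..2} \<times> {1..2}" for i
      using joint_tail_half_bigo[of "X (fst i)" "Y (snd i)"] X Y DL2 that
      by (auto simp: h_def[abs_def] DL2_def)
    then have "(\<lambda>p. s (1 / 2 * fst p, 1 / 2 * snd p)) \<in> O[?F](s)"
      using h_nonneg
      by (intro bigo_transfer_scaling[OF equiv] sum_bigo_nonneg
            filterlim_at_top_prod_map filterlim_at_top_scale) auto
    then show "(\<lambda>p. joint_tail M (\<lambda>\<omega>. X 1 \<omega> + X 2 \<omega>) (\<lambda>\<omega>. Y 1 \<omega> + Y 2 \<omega>) (fst p / 2) (snd p / 2))
        \<in> O[?F](\<lambda>p. joint_tail M (\<lambda>\<omega>. X 1 \<omega> + X 2 \<omega>) (\<lambda>\<omega>. Y 1 \<omega> + Y 2 \<omega>) (fst p) (snd p))"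
      by (simp add: s_def[abs_def])
  qed
  moreover have "s = (\<lambda>(x, y). \<P>(\<omega> in M. X 1 \<omega> + X 2 \<omega> > x \<and> Y 1 \<omega> + Y 2 \<omega> > y))"
    by (auto simp: s_def joint_tail_def)
  moreover have "(\<lambda>p. \<Sum>i\<in>{1..2} \<times> {1..2}. h i p)
      = (\<lambda>(x, y). \<Sum>k=1..2. \<Sum>l=1..2. \<P>(\<omega> in M. X k \<omega> > x \<and> Y l \<omega> > y))"
    by (simp add: h_def joint_tail_def case_prod_unfold sum.cartesian_product)
  ultimately show ?thesis
    using equiv by simp
qed

end
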